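(* Let $X$ be the generic or the generic symmetric $n\times n$ matrix and let $1\le i<j\le n$. Then $I_2(\widetilde X_{ij})\cap\langle g_i\rangle=I_2(\widetilde X_{ij})\cdot\langle g_i\rangle$, that is, the ideals $I_2(\widetilde X_{ij})$ and $\langle g_i\rangle$ intersect transversally.
   Context: $K$ is a field, $n\ge2$. $X=(x_{ij})$ is an $n\times n$ matrix whose entries are indeterminates over $K$: in the generic case all $x_{ij}$ are independent; in the generic symmetric case $x_{ij}=x_{ji}$ and the $x_{ij}$ with $i\le j$ are independent. $Y=(y_1,\ldots,y_n)^t$ is a column of further independent indeterminates, and $R=K[x_{ij},y_j]$ is the polynomial ring in all these indeterminates. $g_r=\sum_{s=1}^n x_{rs}y_s$ is the $r$-th entry of $XY$. $\widetilde X_{ij}$ is the $2\times n$ matrix consisting of the $i$-th and $j$-th rows of $X$, and $I_2(\widetilde X_{ij})\subseteq R$ is the ideal generated by its $2\times2$ minors. Ideals $I,J$ intersect transversally if $I\cap J=IJ$. *)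

theory Defs
  imports
    "HOL-Analysis.Determinants"
    "HOL-Library.Poly_Mapping"
    "HOL-Library.Uprod"
    "HOL-Algebra.Ideal_Product"
    "HOL-Algebra.Algebraic_Closure_Type"
begin

unbundle no fps_syntax

text \<open>
  The index set $\{1, \ldots, n\}$ is a finite linearly ordered type \<open>'n\<close>. The entries of \<open>X\<close> are
  indexed by \<open>'p\<close>: ordered pairs of indices in the generic case, unordered pairs (including the
  degenerate ones $\{i, i\}$) in the generic symmetric case, so that $x_{ij}$ and $x_{ji}$ are
  the same indeterminate there and there are no further identifications.
\<close>

datatype ('p, 'n) indet = XVar 'p | YVar 'n

text \<open>
  The polynomial ring $R = K[x_{ij}, y_j]$: finitely supported functions from monomials (exponent
  vectors) to the field \<open>'k\<close>.
\<close>

type_synonym ('p, 'n, 'k) mpoly_ring = "(('p, 'n) indet \<Rightarrow>\<^sub>0 nat) \<Rightarrow>\<^sub>0 'k"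

definition indet_poly :: "('p, 'n) indet \<Rightarrow> ('p, 'n, 'k::field) mpoly_ring" where
  "indet_poly v = Poly_Mapping.single (Poly_Mapping.single v 1) 1"

definition generic_matrix :: "(('n \<times> 'n, 'n, 'k::field) mpoly_ring)^'n^'n" where
  "generic_matrix = (\<chi> i j. indet_poly (XVar (i, j)))"

definition generic_sym_matrix :: "(('n uprod, 'n, 'k::field) mpoly_ring)^'n^'n" where
  "generic_sym_matrix = (\<chi> i j. indet_poly (XVar (Upair i j)))"

definition y_column :: "(('p, 'n, 'k::field) mpoly_ring)^'n" where
  "y_column = (\<chi> i. indet_poly (YVar i))"

definition two_rows :: "'n \<Rightarrow> 'n \<Rightarrow> ('a::zero)^'n^'n \<Rightarrow> 'a^'n^2" where
  "two_rows i j A = vector [row i A, row j A]"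

text \<open>
  The minor on columns \<open>k < l\<close>. The two elements of the index type \<open>2\<close> are \<open>1\<close> and \<open>2 = 0\<close>.
\<close>

definition minors_2 :: "('a::comm_ring_1)^('n::{finite,linorder})^2 \<Rightarrow> 'a set" where
  "minors_2 M = {det ((\<chi> r c. M $ r $ (if c = 1 then k else l)) :: 'a^2^2) | k l. k < l}"

definition I_2 :: "('a::comm_ring_1)^('n::{finite,linorder})^2 \<Rightarrow> 'a set" where
  "I_2 M = Idl\<^bsub>ring_of_type_algebra\<^esub> (minors_2 M)"

end

theory Submission
  imports Defs
begin

text \<open>
  The ideal $I_2$ of the two rows turns out to be the kernel of a ring homomorphism \<open>\<phi>\<close> into an
  integral domain, and \<open>\<phi>\<close> does not kill $g_i$. This is enough: if $f g_i \in I_2$, then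
  \<open>\<phi>\<close>$(f)\,$\<open>\<phi>\<close>$(g_i) = 0$, hence $f \in I_2$ and $f g_i \in I_2 \cdot \langle g_i\rangle$
  (\<open>kernel_inter_principal_ideal\<close>).

  Write $a_s = x_{is}$ and $b_s = x_{js}$. In the generic case \<open>\<phi>\<close> is the parametrization
  $a_s \mapsto t_s u$, $b_s \mapsto t_s v$ of the matrices of rank at most one, with all other
  indeterminates left alone. In the symmetric case $a_j$ and $b_i$ are the same indeterminate; the
  parametrization remains well defined after specializing $t_i = u$ and $t_j = v$, so that the
  columns $i$ and $j$ become the symmetric square $u^2, uv, uv, v^2$.

  The minors obviously lie in the kernel. The converse is combinatorial
  (\<open>row_minors_kernel\<close>). The map \<open>\<phi>\<close> sends monomials to monomials, so its kernel is spanned by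
  the differences of monomials with the same image, and it remains to see that two such monomials
  \<open>m\<close>, \<open>m'\<close> are congruent modulo $I_2$. If they have an indeterminate in common, cancel it and
  induct on the degree; so it is enough to replace \<open>m'\<close> by a congruent monomial that shares an
  indeterminate with \<open>m\<close> (\<open>share_indeterminate\<close>). Suppose that $a_s$ divides \<open>m\<close> but not \<open>m'\<close>.
  Comparing exponents of $t_s$ and of $u$ in the common image shows that \<open>m'\<close> is divisible by $b_s$
  and by some $a_t$, and the minor of the columns $s, t$ exchanges $a_t b_s$ for $a_s b_t$.
  Only the symmetric square, where no $t_s$ is available, needs a separate comparison of exponents
  of $u$ and $v$ (\<open>share_in_square\<close>).

  Finally \<open>\<phi>\<close>$(g_i) \neq 0$ because its terms \<open>\<phi>\<close>$(x_{is})\, y_s$ involve different $y_s$.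
\<close>

section \<open>Monomial maps\<close>

text \<open>
  The linear map of monoid algebras $K[A] \to K[B]$ that is induced by a map of the exponents. It is
  a ring homomorphism as soon as the map of exponents is additive.
\<close>

definition monomial_map :: "('a \<Rightarrow> 'b) \<Rightarrow> ('a \<Rightarrow>\<^sub>0 'k) \<Rightarrow> ('b \<Rightarrow>\<^sub>0 'k::comm_monoid_add)" where
  "monomial_map w f = (\<Sum>m\<in>Poly_Mapping.keys f. Poly_Mapping.single (w m) (Poly_Mapping.lookup f m))"

lemma monomial_map_superset:
  assumes "finite A" "Poly_Mapping.keys f \<subseteq> A"
  shows "monomial_map w f = (\<Sum>m\<in>A. Poly_Mapping.single (w m) (Poly_Mapping.lookup f m))"
  unfolding monomial_map_def using assms
  by (intro sum.mono_neutral_left) (auto simp: in_keys_iff)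

lemma monomial_map_zero [simp]: "monomial_map w 0 = 0"
  by (simp add: monomial_map_def)

lemma monomial_map_single [simp]:
  "monomial_map w (Poly_Mapping.single m c) = Poly_Mapping.single (w m) c"
  by (cases "c = 0") (simp_all add: monomial_map_def)

lemma monomial_map_add: "monomial_map w (f + g) = monomial_map w f + monomial_map w g"
proof -
  let ?A = "Poly_Mapping.keys f \<union> Poly_Mapping.keys g"
  have "Poly_Mapping.keys (f + g) \<subseteq> ?A"
    by (rule Poly_Mapping.keys_add)
  then show ?thesis
    by (simp add: monomial_map_superset[where A = ?A] lookup_add single_add sum.distrib)
qed

lemma monomial_map_sum: "monomial_map w (\<Sum>x\<in>A. f x) = (\<Sum>x\<in>A. monomial_map w (f x))"
  by (induction A rule: infinite_finite_induct) (simp_all add: monomial_map_add)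

lemma monomial_map_diff:
  fixes f g :: "'a \<Rightarrow>\<^sub>0 'k::ab_group_add"
  shows "monomial_map w (f - g) = monomial_map w f - monomial_map w g"
  using monomial_map_add[of w "f - g" g] by simp

lemma poly_mapping_eq_sum_single:
  "f = (\<Sum>m\<in>Poly_Mapping.keys f. Poly_Mapping.single m (Poly_Mapping.lookup f m))"
  by (rule poly_mapping_eqI) (auto simp: lookup_sum lookup_single when_def sum.delta in_keys_iff)

lemma monomial_map_compose:
  "monomial_map v (monomial_map w f) = monomial_map (\<lambda>m. v (w m)) f"
  by (simp add: monomial_map_def[of w] monomial_map_sum) (simp add: monomial_map_def)

lemma monomial_map_mult:
  fixes f g :: "'a::comm_monoid_add \<Rightarrow>\<^sub>0 'k::comm_semiring_0"
    and w :: "'a \<Rightarrow> 'b::comm_monoid_add"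
  assumes "\<And>m m'. w (m + m') = w m + w m'"
  shows "monomial_map w (f * g) = monomial_map w f * monomial_map w g"
proof -
  have "f * g = (\<Sum>m\<in>Poly_Mapping.keys f. \<Sum>m'\<in>Poly_Mapping.keys g.
      Poly_Mapping.single (m + m') (Poly_Mapping.lookup f m * Poly_Mapping.lookup g m'))"
    by (subst (1) poly_mapping_eq_sum_single[of f], subst (1) poly_mapping_eq_sum_single[of g])
      (simp add: sum_product mult_single)
  then show ?thesis
    by (simp add: monomial_map_sum assms monomial_map_def[of w f] monomial_map_def[of w g]
        sum_product mult_single)
qed

section \<open>Ideals of a commutative ring type\<close>

lemma ideal_type_algebra:
  fixes J :: "'a::comm_ring_1 set"
  assumes "ideal J ring_of_type_algebra"
  shows ideal_zero_mem: "0 \<in> J"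
    and ideal_add_mem: "\<And>f g. f \<in> J \<Longrightarrow> g \<in> J \<Longrightarrow> f + g \<in> J"
    and ideal_mult_mem: "\<And>f g. f \<in> J \<Longrightarrow> g * f \<in> J"
    and ideal_uminus_mem: "\<And>f. f \<in> J \<Longrightarrow> - f \<in> J"
proof -
  interpret ideal J "ring_of_type_algebra :: 'a ring"
    by (rule assms)
  show "0 \<in> J"
    using additive_subgroup.zero_closed[OF additive_subgroup_axioms] by (simp add: ring_of_type_algebra_def)
  show "f + g \<in> J" if "f \<in> J" "g \<in> J" for f g
    using additive_subgroup.a_closed[OF additive_subgroup_axioms that] by (simp add: ring_of_type_algebra_def)
  show mult: "g * f \<in> J" if "f \<in> J" for f g
    using I_l_closed[OF that, of g] by (simp add: ring_of_type_algebra_def)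
  show "- f \<in> J" if "f \<in> J" for f
    using mult[OF that, of "- 1"] by simp
qed

lemma ideal_sum_mem:
  fixes J :: "'a::comm_ring_1 set"
  assumes "ideal J ring_of_type_algebra" "\<And>x. x \<in> A \<Longrightarrow> f x \<in> J"
  shows "(\<Sum>x\<in>A. f x) \<in> J"
  using assms(2)
  by (induction A rule: infinite_finite_induct)
    (auto intro: ideal_zero_mem[OF assms(1)] ideal_add_mem[OF assms(1)])

lemma ideal_kernel:
  fixes \<phi> :: "'a::comm_ring_1 \<Rightarrow> 'b::comm_ring_1"
  assumes add: "\<And>f g. \<phi> (f + g) = \<phi> f + \<phi> g" and mult: "\<And>f g. \<phi> (f * g) = \<phi> f * \<phi> g"
  shows "ideal {f. \<phi> f = 0} ring_of_type_algebra"
proof -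
  interpret cring "ring_of_type_algebra :: 'a ring" by (rule cring_from_type_algebra)
  have zero: "\<phi> 0 = 0" using add[of 0 0] by simp
  have neg: "\<phi> (- f) = - \<phi> f" for f
    using add[of f "- f"] zero by (simp add: eq_neg_iff_add_eq_0 add.commute)
  have ainv: "inv\<^bsub>add_monoid ring_of_type_algebra\<^esub> f = - f" for f :: 'a
  proof -
    have "\<ominus>\<^bsub>ring_of_type_algebra\<^esub> f = - f"
      by (rule minus_equality) (simp_all add: ring_of_type_algebra_def)
    then show ?thesis by (simp add: a_inv_def)
  qed
  have "subgroup {f. \<phi> f = 0} (add_monoid ring_of_type_algebra)"
    by (rule group.subgroupI[OF a_group])
      (auto simp: ainv[unfolded ring_of_type_algebra_def, simplified] neg zero add ring_of_type_algebra_def intro!: exI[of _ 0])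
  then show ?thesis
    by (intro idealI ring_axioms) (auto simp: mult ring_of_type_algebra_def)
qed

lemma genideal_subset_iff:
  fixes S J :: "'a::comm_ring_1 set"
  assumes "ideal J ring_of_type_algebra"
  shows "Idl\<^bsub>ring_of_type_algebra\<^esub> S \<subseteq> J \<longleftrightarrow> S \<subseteq> J"
proof -
  interpret cring "ring_of_type_algebra :: 'a ring" by (rule cring_from_type_algebra)
  have "S \<subseteq> Idl\<^bsub>ring_of_type_algebra\<^esub> S"
    by (rule genideal_self) (simp add: ring_of_type_algebra_def)
  then show ?thesis
    using genideal_minimal[OF assms] by blast
qed

lemma ideal_genideal:
  fixes S :: "'a::comm_ring_1 set"
  shows "ideal (Idl\<^bsub>ring_of_type_algebra\<^esub> S) ring_of_type_algebra"
  using ring.genideal_ideal[OF ring_from_type_algebra, of S] by (simp add: ring_of_type_algebra_def)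

text \<open>
  The quotient by the kernel of a homomorphism into a domain is a domain, so an element outside the
  kernel is a nonzerodivisor modulo it. Every multiple of \<open>g\<close> in \<open>J\<close> is therefore a multiple by an
  element of \<open>J\<close>.
\<close>

lemma kernel_inter_principal_ideal:
  fixes \<phi> :: "'a::comm_ring_1 \<Rightarrow> 'b::idom"
  assumes ideal: "ideal J ring_of_type_algebra"
    and kernel: "\<And>f. f \<in> J \<longleftrightarrow> \<phi> f = 0"
    and mult: "\<And>f g. \<phi> (f * g) = \<phi> f * \<phi> g"
    and g: "\<phi> g \<noteq> 0"
  shows "J \<inter> (PIdl\<^bsub>ring_of_type_algebra\<^esub> g) =
    J \<cdot>\<^bsub>ring_of_type_algebra\<^esub> (PIdl\<^bsub>ring_of_type_algebra\<^esub> g)"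
proof -
  interpret cring "ring_of_type_algebra :: 'a ring" by (rule cring_from_type_algebra)
  have carrier: "x \<in> carrier ring_of_type_algebra" for x :: 'a
    by (simp add: ring_of_type_algebra_def)
  have "h \<in> J \<cdot>\<^bsub>ring_of_type_algebra\<^esub> (PIdl\<^bsub>ring_of_type_algebra\<^esub> g)"
    if h: "h \<in> J" "h \<in> PIdl\<^bsub>ring_of_type_algebra\<^esub> g" for h
  proof -
    obtain f where f: "h = f * g"
      using h(2) by (auto simp: cgenideal_def ring_of_type_algebra_def)
    have "f \<in> J"
      using h(1) g by (simp add: kernel f mult)
    from ideal_prod.prod[OF this cgenideal_self[OF carrier[of g]], where R = ring_of_type_algebra]
    show ?thesis
      by (simp add: f ring_of_type_algebra_def)
  qed
  with ideal_prod_inter[OF ideal cgenideal_ideal[OF carrier[of g]]] show ?thesis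
    by blast
qed

section \<open>Weights of monomials\<close>

text \<open>
  The additive extension of \<open>wt\<close> from the indeterminates to all monomials. With values in exponent
  vectors, it is the effect on exponents of a substitution of monomials for the indeterminates; with
  values in \<open>nat\<close>, it is a weighted degree.
\<close>

definition weight :: "('v \<Rightarrow> 'b::comm_semiring_1) \<Rightarrow> ('v \<Rightarrow>\<^sub>0 nat) \<Rightarrow> 'b" where
  "weight wt m = (\<Sum>v\<in>Poly_Mapping.keys m. of_nat (Poly_Mapping.lookup m v) * wt v)"

lemma weight_superset:
  assumes "finite A" "\<And>v. v \<in> Poly_Mapping.keys m \<Longrightarrow> v \<notin> A \<Longrightarrow> wt v = 0"
  shows "weight wt m = (\<Sum>v\<in>A. of_nat (Poly_Mapping.lookup m v) * wt v)"
  unfolding weight_def using assms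
  by (intro sum.mono_neutral_cong) (auto simp: in_keys_iff)

lemma weight_add: "weight wt (m + m') = weight wt m + weight wt m'"
proof -
  let ?A = "Poly_Mapping.keys m \<union> Poly_Mapping.keys m'"
  have "weight wt n = (\<Sum>v\<in>?A. of_nat (Poly_Mapping.lookup n v) * wt v)"
    if "Poly_Mapping.keys n \<subseteq> ?A" for n
    using that by (intro weight_superset) auto
  from this[of "m + m'"] this[of m] this[of m'] Poly_Mapping.keys_add[of m m'] show ?thesis
    by (simp add: lookup_add distrib_right sum.distrib)
qed

lemma weight_single [simp]: "weight wt (Poly_Mapping.single v n) = of_nat n * wt v"
  by (cases "n = 0") (simp_all add: weight_def)

lemma weight_zero [simp]: "weight wt 0 = 0"
  by (simp add: weight_def)

lemma lookup_weight:
  fixes wt :: "'v \<Rightarrow> 'c::comm_monoid_add \<Rightarrow>\<^sub>0 nat"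
  shows "Poly_Mapping.lookup (weight wt m) c = weight (\<lambda>v. Poly_Mapping.lookup (wt v) c) m"
proof -
  have "Poly_Mapping.lookup (of_nat n * p) c = n * Poly_Mapping.lookup p c"
    for n and p :: "'c \<Rightarrow>\<^sub>0 nat"
    by (induction n) (simp_all add: distrib_right lookup_add)
  then show ?thesis
    by (simp add: weight_def lookup_sum)
qed

lemma weight_pos_iff:
  fixes wt :: "'v \<Rightarrow> nat"
  shows "weight wt m > 0 \<longleftrightarrow> (\<exists>v\<in>Poly_Mapping.keys m. wt v > 0)"
  by (simp add: weight_def in_keys_iff zero_less_iff_neq_zero del: neq0_conv)

text \<open>
  Exponents are nonnegative, so contributions to a coordinate cannot cancel: a coordinate of the
  weight is positive exactly when some indeterminate of the monomial contributes to it.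
\<close>

lemma weight_coordinate_transfer:
  fixes wt :: "'v \<Rightarrow> 'c::comm_monoid_add \<Rightarrow>\<^sub>0 nat"
  assumes "weight wt m = weight wt m'" "v \<in> Poly_Mapping.keys m"
    "Poly_Mapping.lookup (wt v) c > 0"
  shows "\<exists>v'\<in>Poly_Mapping.keys m'. Poly_Mapping.lookup (wt v') c > 0"
proof -
  have "weight (\<lambda>v. Poly_Mapping.lookup (wt v) c) m > 0"
    using assms(2,3) by (auto simp: weight_pos_iff)
  then have "weight (\<lambda>v. Poly_Mapping.lookup (wt v) c) m' > 0"
    using assms(1) by (metis lookup_weight)
  then show ?thesis
    by (simp add: weight_pos_iff)
qed

section \<open>Congruent monomials\<close>

definition monomial_cong :: "('m::comm_monoid_add \<Rightarrow>\<^sub>0 'k::comm_ring_1) set \<Rightarrow> 'm \<Rightarrow> 'm \<Rightarrow> bool" where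
  "monomial_cong J m m' \<longleftrightarrow> Poly_Mapping.single m 1 - Poly_Mapping.single m' 1 \<in> J"

lemma monomial_cong_refl:
  assumes "ideal J ring_of_type_algebra"
  shows "monomial_cong J m m"
  by (simp add: monomial_cong_def ideal_zero_mem[OF assms])

lemma monomial_cong_sym:
  assumes "ideal J ring_of_type_algebra" "monomial_cong J m m'"
  shows "monomial_cong J m' m"
  using ideal_uminus_mem[OF assms(1)] assms(2) by (fastforce simp: monomial_cong_def)

lemma monomial_cong_trans:
  assumes "ideal J ring_of_type_algebra" "monomial_cong J m m'" "monomial_cong J m' m''"
  shows "monomial_cong J m m''"
  using ideal_add_mem[OF assms(1) assms(2,3)[unfolded monomial_cong_def]]
  by (simp add: monomial_cong_def)

lemma ideal_single_diff_mem:
  assumes "ideal J ring_of_type_algebra" "monomial_cong J m m'"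
  shows "Poly_Mapping.single (n + m) c - Poly_Mapping.single (n + m') c \<in> J"
  using ideal_mult_mem[OF assms(1) assms(2)[unfolded monomial_cong_def],
      of "Poly_Mapping.single n c"]
  by (simp add: right_diff_distrib mult_single)

lemma monomial_cong_add:
  assumes "ideal J ring_of_type_algebra" "monomial_cong J m m'"
  shows "monomial_cong J (n + m) (n + m')"
  using ideal_single_diff_mem[OF assms, of n 1] by (simp add: monomial_cong_def)

text \<open>
  Choose a representative in each fibre of \<open>w\<close>. Replacing every monomial of \<open>f\<close> by its
  representative changes \<open>f\<close> by an element of \<open>J\<close> only, and the result is determined by the image of
  \<open>f\<close>, hence is zero when \<open>f\<close> lies in the kernel.
\<close>

lemma kernel_monomial_map_subset:
  fixes J :: "('m::comm_monoid_add \<Rightarrow>\<^sub>0 'k::comm_ring_1) set" and w :: "'m \<Rightarrow> 'b"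
  assumes J: "ideal J ring_of_type_algebra"
    and cong: "\<And>m m'. w m = w m' \<Longrightarrow> monomial_cong J m m'"
    and kernel: "monomial_map w f = 0"
  shows "f \<in> J"
proof -
  \<comment> \<open>The representative depends on the value of \<open>w\<close> only.\<close>
  define r where "r m = (SOME m'. w m' = w m)" for m
  have w_r: "w (r m) = w m" for m
    unfolding r_def by (rule someI[of _ m]) simp
  have "monomial_map r f = monomial_map (\<lambda>c. SOME m'. w m' = c) (monomial_map w f)"
    by (simp add: monomial_map_compose r_def[abs_def])
  then have "monomial_map r f = 0"
    by (simp add: kernel)
  then have "f = (\<Sum>m\<in>Poly_Mapping.keys f. Poly_Mapping.single m (Poly_Mapping.lookup f m) -
      Poly_Mapping.single (r m) (Poly_Mapping.lookup f m))"
    by (simp add: sum_subtractf monomial_map_def flip: poly_mapping_eq_sum_single)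
  also have "\<dots> \<in> J"
    using ideal_single_diff_mem[OF J cong[OF w_r[symmetric]], of 0]
    by (intro ideal_sum_mem[OF J]) simp
  finally show ?thesis .
qed

lemma poly_mapping_remove_key:
  fixes m :: "'v \<Rightarrow>\<^sub>0 nat"
  assumes "v \<in> Poly_Mapping.keys m"
  obtains n where "m = Poly_Mapping.single v 1 + n"
proof
  show "m = Poly_Mapping.single v 1 + (m - Poly_Mapping.single v 1)"
    using assms
    by (intro poly_mapping_eqI) (auto simp: lookup_add lookup_minus lookup_single when_def in_keys_iff)
qed

text \<open>
  Induction on the degree of \<open>m\<close>. Once \<open>m'\<close> has been replaced by a congruent monomial with an
  indeterminate in common with \<open>m\<close>, that indeterminate can be cancelled on both sides without
  disturbing the equality of weights. The weights of single indeterminates must not vanish, so that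
  only the monomial 1 has weight 0.
\<close>

lemma monomial_cong_if_weight_eq:
  fixes J :: "(('v \<Rightarrow>\<^sub>0 nat) \<Rightarrow>\<^sub>0 'k::comm_ring_1) set"
    and wt :: "'v \<Rightarrow> 'c::comm_monoid_add \<Rightarrow>\<^sub>0 nat"
  assumes J: "ideal J ring_of_type_algebra"
    and cong_weight: "\<And>m m'. monomial_cong J m m' \<Longrightarrow> weight wt m = weight wt m'"
    and wt_nonzero: "\<And>v. wt v \<noteq> 0"
    and share: "\<And>m m'. weight wt m = weight wt m' \<Longrightarrow> m \<noteq> 0 \<Longrightarrow>
      \<exists>m'' v. monomial_cong J m' m'' \<and> v \<in> Poly_Mapping.keys m \<and> v \<in> Poly_Mapping.keys m''"
    and eq: "weight wt m = weight wt m'"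
  shows "monomial_cong J m m'"
  using eq
proof (induction "weight (\<lambda>_. 1 :: nat) m" arbitrary: m m' rule: less_induct)
  case less
  show ?case
  proof (cases "m = 0")
    case True
    have "m' = 0"
    proof (rule ccontr)
      assume "m' \<noteq> 0"
      then obtain v where v: "v \<in> Poly_Mapping.keys m'"
        by (metis poly_mapping_eqI in_keys_iff lookup_zero)
      obtain c where "Poly_Mapping.lookup (wt v) c > 0"
        using wt_nonzero[of v] by (metis poly_mapping_eqI lookup_zero not_gr_zero)
      with weight_coordinate_transfer[OF less.prems[symmetric] v] True show False
        by (simp only: keys_zero) blast
    qed
    with True show ?thesis
      by (simp add: monomial_cong_refl[OF J])
  next
    case False
    with share less.prems obtain m'' v where m'': "monomial_cong J m' m''"
      and v: "v \<in> Poly_Mapping.keys m" "v \<in> Poly_Mapping.keys m''"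
      by blast
    obtain n where n: "m = Poly_Mapping.single v 1 + n"
      using v(1) by (rule poly_mapping_remove_key)
    obtain n'' where n'': "m'' = Poly_Mapping.single v 1 + n''"
      using v(2) by (rule poly_mapping_remove_key)
    have "weight wt n = weight wt n''"
      using less.prems cong_weight[OF m''] by (simp add: n n'' weight_add)
    then have "monomial_cong J n n''"
      by (rule less.hyps[rotated]) (simp add: n weight_add)
    then have "monomial_cong J m m''"
      unfolding n n'' by (rule monomial_cong_add[OF J])
    with m'' show ?thesis
      using monomial_cong_sym[OF J] monomial_cong_trans[OF J] by blast
  qed
qed

section \<open>Two rows of indeterminates\<close>

abbreviation var :: "'v \<Rightarrow> ('v \<Rightarrow>\<^sub>0 nat) \<Rightarrow>\<^sub>0 'k::comm_ring_1" where
  "var v \<equiv> Poly_Mapping.single (Poly_Mapping.single v 1) 1"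

text \<open>
  All ordered pairs of columns are admitted. Compared with the minors of columns \<open>s < t\<close> this only
  adds their negatives and 0, and it makes the set symmetric in the two rows and independent of an
  order of the columns.
\<close>

definition row_minors :: "('n \<Rightarrow> 'v) \<Rightarrow> ('n \<Rightarrow> 'v) \<Rightarrow> (('v \<Rightarrow>\<^sub>0 nat) \<Rightarrow>\<^sub>0 'k::comm_ring_1) set" where
  "row_minors a b = {var (a s) * var (b t) - var (a t) * var (b s) | s t. True}"

lemma row_minors_commute: "row_minors b a = row_minors a b"
proof -
  have "row_minors b a \<subseteq> row_minors a b" for a b :: "'n \<Rightarrow> 'v"
    unfolding row_minors_def by (auto simp: mult.commute)
  then show ?thesis by blast
qed

lemma monomial_cong_exchange:
  assumes J: "ideal J ring_of_type_algebra" and minors: "row_minors a b \<subseteq> J"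
  shows "monomial_cong J
    (n + (Poly_Mapping.single (a s) 1 + Poly_Mapping.single (b t) 1))
    (n + (Poly_Mapping.single (a t) 1 + Poly_Mapping.single (b s) 1))"
proof (rule monomial_cong_add[OF J])
  have "var (a s) * var (b t) - var (a t) * var (b s) \<in> J"
    using minors by (auto simp: row_minors_def)
  then show "monomial_cong J
      (Poly_Mapping.single (a s) 1 + Poly_Mapping.single (b t) 1)
      (Poly_Mapping.single (a t) 1 + Poly_Mapping.single (b s) 1)"
    by (simp add: monomial_cong_def mult_single)
qed

lemma poly_mapping_remove_two_keys:
  fixes m :: "'v \<Rightarrow>\<^sub>0 nat"
  assumes "v \<in> Poly_Mapping.keys m" "u \<in> Poly_Mapping.keys m"
    and "v = u \<Longrightarrow> Poly_Mapping.lookup m v \<ge> 2"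
  obtains n where "m = n + (Poly_Mapping.single v 1 + Poly_Mapping.single u 1)"
proof -
  obtain n where n: "m = Poly_Mapping.single v 1 + n"
    using assms(1) by (rule poly_mapping_remove_key)
  have "u \<in> Poly_Mapping.keys n"
    using assms(2,3) by (auto simp: n in_keys_iff lookup_add lookup_single when_def split: if_splits)
  then obtain n' where "n = Poly_Mapping.single u 1 + n'"
    by (rule poly_mapping_remove_key)
  with n have "m = n' + (Poly_Mapping.single v 1 + Poly_Mapping.single u 1)"
    by (simp only: add_ac)
  then show ?thesis
    by (rule that)
qed

text \<open>
  The exchange step. The coordinate \<open>c\<close> belongs to column \<open>s\<close> and the coordinate \<open>u\<close> to the row \<open>a\<close>. If
  \<open>a s\<close> is missing from \<open>m'\<close>, then coordinate \<open>c\<close> of the weight forces \<open>b s\<close> in \<open>m'\<close>, coordinate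
  \<open>u\<close> forces some \<open>a t\<close>, and a minor exchanges \<open>a t\<close>, \<open>b s\<close> for \<open>a s\<close>, \<open>b t\<close>. Since \<open>b s\<close> is not in the
  row \<open>a\<close>, the indeterminates \<open>a t\<close> and \<open>b s\<close> are distinct, so their product divides \<open>m'\<close>.
\<close>

lemma share_row_indeterminate:
  fixes wt :: "'v \<Rightarrow> 'c::comm_monoid_add \<Rightarrow>\<^sub>0 nat"
  assumes J: "ideal J ring_of_type_algebra" and minors: "row_minors a b \<subseteq> J"
    and row: "\<And>v. Poly_Mapping.lookup (wt v) u > 0 \<longleftrightarrow> v \<in> range a"
    and column: "\<And>v. Poly_Mapping.lookup (wt v) c > 0 \<longleftrightarrow> v \<in> {a s, b s}"
    and b: "b s \<notin> range a"
    and eq: "weight wt m = weight wt m'" and s: "a s \<in> Poly_Mapping.keys m"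
  shows "\<exists>m''. monomial_cong J m' m'' \<and> a s \<in> Poly_Mapping.keys m''"
proof (cases "a s \<in> Poly_Mapping.keys m'")
  case True
  with monomial_cong_refl[OF J] show ?thesis by blast
next
  case False
  have "b s \<in> Poly_Mapping.keys m'"
    using weight_coordinate_transfer[OF eq s, of c] False unfolding column by blast
  moreover obtain t where "a t \<in> Poly_Mapping.keys m'"
    using weight_coordinate_transfer[OF eq s, of u] unfolding row by blast
  moreover have "a t \<noteq> b s"
    using b by (metis rangeI)
  ultimately obtain n where n: "m' = n + (Poly_Mapping.single (a t) 1 + Poly_Mapping.single (b s) 1)"
    by (metis poly_mapping_remove_two_keys)
  show ?thesis
  proof (intro exI conjI)
    show "monomial_cong J m' (n + (Poly_Mapping.single (a s) 1 + Poly_Mapping.single (b t) 1))"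
      unfolding n by (rule monomial_cong_exchange[OF J minors])
    show "a s \<in> Poly_Mapping.keys (n + (Poly_Mapping.single (a s) 1 + Poly_Mapping.single (b t) 1))"
      by (simp add: in_keys_iff lookup_add)
  qed
qed

text \<open>
  A common frame for the two cases. \<open>S\<close> is the set of columns that have an independent
  parameter $t_s$: all of them in the generic case, where the rows are disjoint, and all but \<open>i\<close>
  and \<open>j\<close> in the symmetric case, where \<open>a j = b i\<close> is the only coincidence. The enumeration \<open>e\<close> of the
  indeterminates is there to name the target indeterminates by natural numbers: their linear order
  induces a compatible linear order on exponent vectors, and this makes the target of the
  parametrization an integral domain.
\<close>

locale row_pair =
  fixes a b :: "'n::finite \<Rightarrow> 'v" and i j :: 'n and S :: "'n set" and e :: "'v \<Rightarrow> nat"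
  assumes inj_a: "inj a" and inj_b: "inj b" and inj_e: "inj e" and i_neq_j: "i \<noteq> j"
    and columns: "S = UNIV \<or> S = - {i, j}"
    and overlap: "\<And>s t. a s = b t \<longleftrightarrow> S \<noteq> UNIV \<and> s = j \<and> t = i"
begin

text \<open>
  The exponent vectors of the target monomials. Coordinates 0 and 1 are those of $u$ and $v$, so
  the enumeration of the other target indeterminates is shifted by 2.
\<close>

definition own :: "'v \<Rightarrow> nat \<Rightarrow>\<^sub>0 nat" where
  "own v = Poly_Mapping.single (e v + 2) 1"

definition U :: "nat \<Rightarrow>\<^sub>0 nat" where
  "U = Poly_Mapping.single 0 1"

definition V :: "nat \<Rightarrow>\<^sub>0 nat" where
  "V = Poly_Mapping.single 1 1"

text \<open>
  The parameter $t_s$; the indeterminate \<open>a s\<close> lends it its name, since \<open>a s\<close> itself does not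
  occur in the target. The specialization $t_i = u$, $t_j = v$ takes place exactly when
  \<open>i\<close> and \<open>j\<close> are not in \<open>S\<close>.
\<close>

definition T :: "'n \<Rightarrow> nat \<Rightarrow>\<^sub>0 nat" where
  "T s = (if s \<in> S then own (a s) else if s = i then U else V)"

definition wt :: "'v \<Rightarrow> nat \<Rightarrow>\<^sub>0 nat" where
  "wt v = (if v \<in> range a then T (inv_into UNIV a v) + U else if v \<in> range b then T (inv_into UNIV b v) + V else own v)"

lemma wt_a [simp]: "wt (a s) = T s + U"
  by (simp add: wt_def inj_a)

text \<open>
  In the symmetric case the value at \<open>b i = a j\<close> is given by the first branch of the definition;
  both formulas yield $uv$.
\<close>

lemma wt_b [simp]: "wt (b s) = T s + V"
proof (cases "b s \<in> range a")
  case True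
  then obtain t where "a t = b s" by auto
  then have "S \<noteq> UNIV" "s = i" and bi: "b i = a j"
    using overlap[of t s] overlap[of j i] by simp_all
  then have "i \<notin> S" "j \<notin> S" using columns by auto
  then show ?thesis
    using i_neq_j \<open>s = i\<close> by (simp add: bi T_def add.commute)
next
  case False
  then show ?thesis by (simp add: wt_def inj_b)
qed

lemma wt_other: "v \<notin> range a \<Longrightarrow> v \<notin> range b \<Longrightarrow> wt v = own v"
  by (simp add: wt_def)

lemma lookup_coordinates:
  "Poly_Mapping.lookup U 0 = 1" "Poly_Mapping.lookup V 0 = 0" "Poly_Mapping.lookup (own v) 0 = 0"
  "Poly_Mapping.lookup U (Suc 0) = 0" "Poly_Mapping.lookup V (Suc 0) = 1"
  "Poly_Mapping.lookup (own v) (Suc 0) = 0"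
  "Poly_Mapping.lookup U (Suc (Suc k)) = 0" "Poly_Mapping.lookup V (Suc (Suc k)) = 0"
  "Poly_Mapping.lookup (own v) (Suc (Suc (e v'))) = (if v = v' then 1 else 0)"
  using inj_e by (auto simp: U_def V_def own_def lookup_single when_def inj_eq)

lemma indeterminate_cases:
  obtains s where "v = a s" | s where "v = b s" "v \<notin> range a" | "v \<notin> range a" "v \<notin> range b"
  by blast

lemma notin_S: "s \<notin> S \<Longrightarrow> S \<noteq> UNIV \<and> (s = i \<or> s = j)"
  using columns by auto

lemma i_in_S: "i \<in> S \<longleftrightarrow> S = UNIV" and j_in_S: "j \<in> S \<longleftrightarrow> S = UNIV"
  using columns by auto

lemma a_j_eq_b_i: "S \<noteq> UNIV \<Longrightarrow> a j = b i"
  using overlap by blast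

lemma a_in_range_b: "a s \<in> range b \<longleftrightarrow> S \<noteq> UNIV \<and> s = j"
proof -
  have "a s \<in> range b \<longleftrightarrow> (\<exists>t. a s = b t)" by auto
  then show ?thesis unfolding overlap by simp
qed

lemma b_in_range_a: "b s \<in> range a \<longleftrightarrow> S \<noteq> UNIV \<and> s = i"
proof -
  have "b s \<in> range a \<longleftrightarrow> (\<exists>t. a t = b s)" by (metis rangeE rangeI)
  then show ?thesis unfolding overlap by simp
qed

lemma row_a_coordinate: "Poly_Mapping.lookup (wt v) 0 > 0 \<longleftrightarrow> v \<in> range a"
proof (cases v rule: indeterminate_cases)
  case (1 s)
  then show ?thesis by (simp add: lookup_add lookup_coordinates)
next
  case (2 s)
  have "Poly_Mapping.lookup (wt v) 0 = 0"
    using 2 b_in_range_a[of s] i_in_S by (auto simp: lookup_add lookup_coordinates T_def)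
  with 2 show ?thesis by simp
next
  case 3
  then show ?thesis by (simp add: wt_other lookup_coordinates)
qed

lemma row_b_coordinate: "Poly_Mapping.lookup (wt v) 1 > 0 \<longleftrightarrow> v \<in> range b"
proof (cases "v \<in> range b")
  case True
  then show ?thesis by (auto simp: lookup_add lookup_coordinates)
next
  case False
  have "Poly_Mapping.lookup (wt v) 1 = 0"
  proof (cases "v \<in> range a")
    case True
    then obtain s where s: "v = a s" by blast
    with False a_in_range_b[of s] notin_S[of s] have "s \<in> S \<or> s = i" by blast
    with s show ?thesis by (auto simp: lookup_add lookup_coordinates T_def)
  qed (simp add: wt_other False lookup_coordinates)
  with False show ?thesis by simp
qed

lemma column_coordinate:
  assumes "s \<in> S"
  shows "Poly_Mapping.lookup (wt v) (e (a s) + 2) > 0 \<longleftrightarrow> v \<in> {a s, b s}"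
proof (cases v rule: indeterminate_cases)
  case (1 t)
  have "a t = b s \<longleftrightarrow> False"
    using overlap[of t s] assms i_in_S by blast
  with 1 assms show ?thesis
    by (simp add: lookup_add lookup_coordinates T_def inj_eq[OF inj_a])
next
  case (2 t)
  then have "b t \<noteq> a s" by blast
  with 2(1) assms show ?thesis
    by (simp add: lookup_add lookup_coordinates T_def inj_eq[OF inj_a] inj_eq[OF inj_b])
next
  case 3
  then have "v \<noteq> a s" "v \<noteq> b s" by auto
  then show ?thesis by (simp add: wt_other[OF 3] lookup_coordinates)
qed

lemma own_coordinate:
  assumes "v \<notin> range a" "v \<notin> range b"
  shows "Poly_Mapping.lookup (wt v') (e v + 2) > 0 \<longleftrightarrow> v' = v"
proof -
  have "a s \<noteq> v" "b s \<noteq> v" for s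
    using assms by auto
  then show ?thesis
    by (cases v' rule: indeterminate_cases) (simp_all add: lookup_add lookup_coordinates T_def wt_other)
qed

lemma wt_nonzero: "wt v \<noteq> 0"
proof
  assume "wt v = 0"
  then have "v \<notin> range a" "v \<notin> range b"
    using row_a_coordinate[of v] row_b_coordinate[of v] by simp_all
  with own_coordinate[of v v] \<open>wt v = 0\<close> show False
    by simp
qed

lemma b_notin_range_a: "s \<in> S \<Longrightarrow> b s \<notin> range a"
  using b_in_range_a[of s] i_in_S by metis

lemma a_notin_range_b: "s \<in> S \<Longrightarrow> a s \<notin> range b"
  using a_in_range_b[of s] j_in_S by metis

text \<open>
  The three entries of the symmetric square have the images $u^2$, $uv$ and $v^2$; coordinates 0 and 1
  are the exponents of $u$ and $v$.
\<close>

lemma square_weights: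
  assumes S: "S \<noteq> UNIV" and keys: "Poly_Mapping.keys m \<subseteq> {a i, a j, b j}"
  shows "Poly_Mapping.lookup (weight wt m) 0 =
      2 * Poly_Mapping.lookup m (a i) + Poly_Mapping.lookup m (a j)"
    and "Poly_Mapping.lookup (weight wt m) 1 =
      Poly_Mapping.lookup m (a j) + 2 * Poly_Mapping.lookup m (b j)"
proof -
  have distinct: "a i \<noteq> a j" "a i \<noteq> b j" "a j \<noteq> b j"
    using i_neq_j overlap[of i j] overlap[of j j] by (simp_all add: inj_eq[OF inj_a])
  have notin: "i \<notin> S" "j \<notin> S"
    using S i_in_S j_in_S by auto
  have "wt (a i) = U + U" "wt (a j) = V + U" "wt (b j) = V + V"
    using i_neq_j notin by (simp_all add: T_def)
  moreover have "Poly_Mapping.lookup (weight wt m) c =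
      (\<Sum>v\<in>{a i, a j, b j}. Poly_Mapping.lookup m v * Poly_Mapping.lookup (wt v) c)" for c
    unfolding lookup_weight using keys by (subst weight_superset[of "{a i, a j, b j}"]) auto
  ultimately show "Poly_Mapping.lookup (weight wt m) 0 =
      2 * Poly_Mapping.lookup m (a i) + Poly_Mapping.lookup m (a j)"
    "Poly_Mapping.lookup (weight wt m) 1 =
      Poly_Mapping.lookup m (a j) + 2 * Poly_Mapping.lookup m (b j)"
    using distinct by (simp_all add: lookup_add lookup_coordinates del: wt_a wt_b)
qed

text \<open>
  On the symmetric square the only nonzero minor is, up to sign, $x_{ii} x_{jj} - x_{ij}^2$. If $x_{ij}$ divides \<open>m\<close> but not
  \<open>m'\<close>, then $u$ and $v$ must come from $x_{ii}$ and $x_{jj}$ in \<open>m'\<close>. If $x_{ii}$ divides \<open>m\<close> but not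
  \<open>m'\<close>, then $u^2$ must come from $x_{ij}^2$ in \<open>m'\<close>; the same holds for $x_{jj}$ and $v^2$.
\<close>

lemma share_in_square:
  fixes J :: "(('v \<Rightarrow>\<^sub>0 nat) \<Rightarrow>\<^sub>0 'k::comm_ring_1) set"
  assumes J: "ideal J ring_of_type_algebra" and minors: "row_minors a b \<subseteq> J"
    and S: "S \<noteq> UNIV" and keys: "Poly_Mapping.keys m \<subseteq> {a i, a j, b j}"
    and keys': "Poly_Mapping.keys m' \<subseteq> {a i, a j, b j}"
    and eq: "weight wt m = weight wt m'" and v: "v \<in> Poly_Mapping.keys m"
  shows "\<exists>m''. monomial_cong J m' m'' \<and> v \<in> Poly_Mapping.keys m''"
proof (cases "v \<in> Poly_Mapping.keys m'")
  case True
  with monomial_cong_refl[OF J] show ?thesis by blast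
next
  case False
  let ?x = "Poly_Mapping.lookup m" and ?x' = "Poly_Mapping.lookup m'"
  have u_eq: "2 * ?x (a i) + ?x (a j) = 2 * ?x' (a i) + ?x' (a j)"
    and v_eq: "?x (a j) + 2 * ?x (b j) = ?x' (a j) + 2 * ?x' (b j)"
    using square_weights[OF S keys] square_weights[OF S keys'] eq by simp_all
  have exchange: "monomial_cong J
      (n + (Poly_Mapping.single (a i) 1 + Poly_Mapping.single (b j) 1))
      (n + (Poly_Mapping.single (a j) 1 + Poly_Mapping.single (a j) 1))" for n
    using monomial_cong_exchange[OF J minors, of n i j] by (simp add: a_j_eq_b_i[OF S])
  show ?thesis
  proof (cases "v = a j")
    case True
    then have "?x (a j) > 0" "?x' (a j) = 0"
      using False v by (auto simp: in_keys_iff)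
    then have "a i \<in> Poly_Mapping.keys m'" "b j \<in> Poly_Mapping.keys m'"
      using u_eq v_eq by (auto simp: in_keys_iff)
    moreover have "a i \<noteq> b j"
      using overlap i_neq_j by blast
    ultimately obtain n where
      n: "m' = n + (Poly_Mapping.single (a i) 1 + Poly_Mapping.single (b j) 1)"
      by (metis poly_mapping_remove_two_keys)
    show ?thesis
    proof (intro exI conjI)
      show "monomial_cong J m' (n + (Poly_Mapping.single (a j) 1 + Poly_Mapping.single (a j) 1))"
        unfolding n by (rule exchange)
      show "v \<in> Poly_Mapping.keys (n + (Poly_Mapping.single (a j) 1 + Poly_Mapping.single (a j) 1))"
        by (simp add: True in_keys_iff lookup_add)
    qed
  next
    case v_neq: False
    then have v_cases: "v = a i \<or> v = b j"
      using v keys by blast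
    have "?x v > 0" "?x' v = 0"
      using False v by (auto simp: in_keys_iff)
    then have "?x' (a j) \<ge> 2"
      using v_cases u_eq v_eq by auto
    moreover from this have "a j \<in> Poly_Mapping.keys m'"
      by (auto simp: in_keys_iff)
    ultimately obtain n where
      n: "m' = n + (Poly_Mapping.single (a j) 1 + Poly_Mapping.single (a j) 1)"
      by (metis poly_mapping_remove_two_keys)
    show ?thesis
    proof (intro exI conjI)
      show "monomial_cong J m' (n + (Poly_Mapping.single (a i) 1 + Poly_Mapping.single (b j) 1))"
        unfolding n by (rule monomial_cong_sym[OF J exchange])
      show "v \<in> Poly_Mapping.keys (n + (Poly_Mapping.single (a i) 1 + Poly_Mapping.single (b j) 1))"
        using v_cases by (auto simp: in_keys_iff lookup_add)
    qed
  qed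
qed

lemma square_member:
  assumes "v \<in> range a \<or> v \<in> range b" "\<And>s. s \<in> S \<Longrightarrow> v \<notin> {a s, b s}"
  shows "S \<noteq> UNIV \<and> v \<in> {a i, a j, b j}"
proof -
  obtain s where s: "v \<in> {a s, b s}"
    using assms(1) by blast
  then have "s \<notin> S"
    using assms(2)[of s] by blast
  then have S: "S \<noteq> UNIV" and "s = i \<or> s = j"
    using notin_S by simp_all
  with s a_j_eq_b_i[OF S] show ?thesis
    by auto
qed

text \<open>
  An indeterminate of \<open>m\<close> in a column from \<open>S\<close> can be exchanged into \<open>m'\<close>, and an indeterminate
  outside both rows occurs in \<open>m'\<close> anyway because it is its own image. If \<open>m\<close> has neither kind, then
  it lives on the symmetric square, and by the coordinates $t_s$ and the coordinates of the other
  indeterminates so does \<open>m'\<close>.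
\<close>

lemma share_indeterminate:
  fixes J :: "(('v \<Rightarrow>\<^sub>0 nat) \<Rightarrow>\<^sub>0 'k::comm_ring_1) set"
  assumes J: "ideal J ring_of_type_algebra" and minors: "row_minors a b \<subseteq> J"
    and eq: "weight wt m = weight wt m'" and m: "m \<noteq> 0"
  shows "\<exists>m'' v. monomial_cong J m' m'' \<and> v \<in> Poly_Mapping.keys m \<and> v \<in> Poly_Mapping.keys m''"
proof -
  obtain v where v: "v \<in> Poly_Mapping.keys m"
    using m by (metis poly_mapping_eqI in_keys_iff lookup_zero)
  consider (column) s where "s \<in> S" "{a s, b s} \<inter> Poly_Mapping.keys m \<noteq> {}"
    | (other) u where "u \<in> Poly_Mapping.keys m" "u \<notin> range a" "u \<notin> range b"
    | (square) "\<And>s. s \<in> S \<Longrightarrow> {a s, b s} \<inter> Poly_Mapping.keys m = {}"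
      "\<And>u. u \<in> Poly_Mapping.keys m \<Longrightarrow> u \<in> range a \<or> u \<in> range b"
    by blast
  then show ?thesis
  proof cases
    case (column s)
    then consider "a s \<in> Poly_Mapping.keys m" | "b s \<in> Poly_Mapping.keys m" by blast
    then show ?thesis
    proof cases
      case 1
      from share_row_indeterminate[OF J minors row_a_coordinate column_coordinate[OF column(1)]
          b_notin_range_a[OF column(1)] eq 1]
      show ?thesis using 1 by blast
    next
      case 2
      have minors': "row_minors b a \<subseteq> J"
        using minors by (subst row_minors_commute)
      have "Poly_Mapping.lookup (wt v) (e (a s) + 2) > 0 \<longleftrightarrow> v \<in> {b s, a s}" for v
        unfolding column_coordinate[OF column(1)] by blast
      from share_row_indeterminate[OF J minors' row_b_coordinate this
          a_notin_range_b[OF column(1)] eq 2]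
      show ?thesis using 2 by blast
    qed
  next
    case (other u)
    have "u \<in> Poly_Mapping.keys m'"
      using weight_coordinate_transfer[OF eq other(1), of "e u + 2"]
      unfolding own_coordinate[OF other(2,3)] by blast
    with other(1) monomial_cong_refl[OF J] show ?thesis by blast
  next
    case square
    have m_square: "S \<noteq> UNIV \<and> u \<in> {a i, a j, b j}" if "u \<in> Poly_Mapping.keys m" for u
      using square(2)[OF that]
    proof (rule square_member)
      show "u \<notin> {a s, b s}" if "s \<in> S" for s
        using square(1)[OF that] \<open>u \<in> Poly_Mapping.keys m\<close> by blast
    qed
    then have S: "S \<noteq> UNIV" and keys: "Poly_Mapping.keys m \<subseteq> {a i, a j, b j}"
      using v by blast+
    have keys': "Poly_Mapping.keys m' \<subseteq> {a i, a j, b j}"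
    proof
      fix u assume u: "u \<in> Poly_Mapping.keys m'"
      show "u \<in> {a i, a j, b j}"
      proof (cases "u \<in> range a \<or> u \<in> range b")
        case True
        have "u \<notin> {a s, b s}" if s: "s \<in> S" for s
          using weight_coordinate_transfer[OF eq[symmetric] u, of "e (a s) + 2"] square(1)[OF s]
          unfolding column_coordinate[OF s] by blast
        with square_member[OF True] show ?thesis by blast
      next
        case False
        then have "u \<notin> range a" "u \<notin> range b" by simp_all
        from own_coordinate[OF this]
        have "u \<in> Poly_Mapping.keys m"
          using weight_coordinate_transfer[OF eq[symmetric] u, of "e u + 2"] by simp
        with keys show ?thesis by blast
      qed
    qed
    from share_in_square[OF J minors S keys keys' eq v] v show ?thesis
      by blast
  qed
qed

text \<open>
  The parametrization. Its kernel is the ideal of the minors, and it embeds the quotient in a domain.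
\<close>

definition \<phi> :: "(('v \<Rightarrow>\<^sub>0 nat) \<Rightarrow>\<^sub>0 'k::field) \<Rightarrow> (nat \<Rightarrow>\<^sub>0 nat) \<Rightarrow>\<^sub>0 'k" where
  "\<phi> = monomial_map (weight wt)"

lemma \<phi>_add: "\<phi> (f + g) = \<phi> f + \<phi> g"
  by (simp add: \<phi>_def monomial_map_add)

lemma \<phi>_mult: "\<phi> (f * g) = \<phi> f * \<phi> g"
  by (simp add: \<phi>_def monomial_map_mult weight_add)

theorem row_minors_kernel:
  fixes f :: "('v \<Rightarrow>\<^sub>0 nat) \<Rightarrow>\<^sub>0 'k::field"
  shows "f \<in> Idl\<^bsub>ring_of_type_algebra\<^esub> (row_minors a b) \<longleftrightarrow> \<phi> f = 0"
proof
  let ?J = "Idl\<^bsub>ring_of_type_algebra\<^esub> (row_minors a b) :: (('v \<Rightarrow>\<^sub>0 nat) \<Rightarrow>\<^sub>0 'k) set"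
  have J: "ideal ?J ring_of_type_algebra"
    by (rule ideal_genideal)
  have minors: "row_minors a b \<subseteq> ?J"
    using genideal_subset_iff[OF J] by blast
  have "(row_minors a b :: (('v \<Rightarrow>\<^sub>0 nat) \<Rightarrow>\<^sub>0 'k) set) \<subseteq> {f. \<phi> f = 0}"
    by (auto simp: row_minors_def \<phi>_def monomial_map_diff mult_single weight_add add_ac)
  then have "?J \<subseteq> {f. \<phi> f = 0}"
    using genideal_subset_iff[OF ideal_kernel[of \<phi>, OF \<phi>_add \<phi>_mult]] by blast
  then have kernel: "\<phi> f = 0" if "f \<in> ?J" for f
    using that by blast
  then show "f \<in> ?J \<Longrightarrow> \<phi> f = 0" .
  have cong_weight: "weight wt m = weight wt m'" if "monomial_cong ?J m m'" for m m'
    using kernel[OF that[unfolded monomial_cong_def]]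
    by (simp add: \<phi>_def monomial_map_diff)
      (metis lookup_single_eq lookup_single_not_eq zero_neq_one)
  show "f \<in> ?J" if "\<phi> f = 0"
    using that unfolding \<phi>_def
    by (rule kernel_monomial_map_subset[OF J
          monomial_cong_if_weight_eq[OF J cong_weight wt_nonzero share_indeterminate[OF J minors]],
          rotated -1])
qed

text \<open>
  The images of the terms are distinct monomials, as they are told apart by the coordinates of
  the \<open>y s\<close>; so the coefficient at the image of the term of column \<open>i\<close> is 1.
\<close>

lemma \<phi>_row_combination_nonzero:
  assumes y: "inj y" "range y \<inter> range a = {}" "range y \<inter> range b = {}"
  shows "\<phi> (\<Sum>s\<in>UNIV. var (a s) * var (y s) :: ('v \<Rightarrow>\<^sub>0 nat) \<Rightarrow>\<^sub>0 'k::field) \<noteq> 0"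
proof
  let ?g = "(\<Sum>s\<in>UNIV. var (a s) * var (y s)) :: ('v \<Rightarrow>\<^sub>0 nat) \<Rightarrow>\<^sub>0 'k"
  assume zero: "\<phi> ?g = 0"
  have y_other: "y s \<notin> range a" "y s \<notin> range b" for s
    using y(2,3) by blast+
  have neq: "wt (a s) + wt (y s) \<noteq> wt (a i) + wt (y i)" if "s \<noteq> i" for s
  proof -
    have "y s \<noteq> y i" using that y(1) by (simp add: inj_eq)
    then have zero: "Poly_Mapping.lookup (wt (y s)) (e (y i) + 2) = 0"
      using own_coordinate[OF y_other, of "y s" i] by auto
    have "Poly_Mapping.lookup (wt (a s)) (e (y i) + 2) = 0"
      using own_coordinate[OF y_other, of "a s" i] y_other by (metis not_gr_zero rangeI)
    moreover have "Poly_Mapping.lookup (wt (y i)) (e (y i) + 2) > 0"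
      using own_coordinate[OF y_other, of "y i" i] by simp
    ultimately have "Poly_Mapping.lookup (wt (a s) + wt (y s)) (e (y i) + 2) <
        Poly_Mapping.lookup (wt (a i) + wt (y i)) (e (y i) + 2)"
      using zero by (simp add: lookup_add)
    then show ?thesis by auto
  qed
  have "\<phi> ?g = (\<Sum>s\<in>UNIV. Poly_Mapping.single (wt (a s) + wt (y s)) 1)"
    by (simp add: \<phi>_def monomial_map_sum mult_single weight_add)
  then have "Poly_Mapping.lookup (\<phi> ?g) (wt (a i) + wt (y i)) =
      (\<Sum>s\<in>UNIV. if wt (a s) + wt (y s) = wt (a i) + wt (y i) then 1 else 0)"
    by (simp only: lookup_sum lookup_single when_def)
  also have "\<dots> = (\<Sum>s\<in>UNIV. if s = i then 1 else 0)"
    using neq by (intro sum.cong refl if_cong) auto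
  finally have "Poly_Mapping.lookup (\<phi> ?g) (wt (a i) + wt (y i)) = 1"
    by simp
  then show False
    using zero by simp
qed

theorem row_minors_transversal:
  assumes y: "inj y" "range y \<inter> range a = {}" "range y \<inter> range b = {}"
  defines "g \<equiv> \<Sum>s\<in>UNIV. var (a s) * var (y s) :: ('v \<Rightarrow>\<^sub>0 nat) \<Rightarrow>\<^sub>0 'k::field"
  shows "(Idl\<^bsub>ring_of_type_algebra\<^esub> (row_minors a b)) \<inter> (PIdl\<^bsub>ring_of_type_algebra\<^esub> g) =
    (Idl\<^bsub>ring_of_type_algebra\<^esub> (row_minors a b)) \<cdot>\<^bsub>ring_of_type_algebra\<^esub> (PIdl\<^bsub>ring_of_type_algebra\<^esub> g)"
  by (rule kernel_inter_principal_ideal[where \<phi> = \<phi>, OF ideal_genideal row_minors_kernel \<phi>_mult])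
    (unfold g_def, rule \<phi>_row_combination_nonzero[OF y])

end

section \<open>The generic and the generic symmetric matrix\<close>

lemma I_2_two_rows:
  fixes A :: "((('p, 'n::{finite,linorder}, 'k::field) mpoly_ring, 'n) vec, 'n) vec"
  assumes a: "\<And>s. A $ i $ s = var (a s)" and b: "\<And>s. A $ j $ s = var (b s)"
  shows "I_2 (two_rows i j A) = Idl\<^bsub>ring_of_type_algebra\<^esub> (row_minors a b)"
proof
  have minors: "minors_2 (two_rows i j A) =
      {var (a k) * var (b l) - var (a l) * var (b k) | k l. k < l}"
    by (simp add: minors_2_def two_rows_def det_2 row_def a b)
  have I: "ideal (I_2 (two_rows i j A)) ring_of_type_algebra"
    unfolding I_2_def by (rule ideal_genideal)
  have J: "ideal (Idl\<^bsub>ring_of_type_algebra\<^esub> (row_minors a b) ::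
      ('p, 'n, 'k) mpoly_ring set) ring_of_type_algebra"
    by (rule ideal_genideal)
  have "minors_2 (two_rows i j A) \<subseteq> row_minors a b"
    unfolding minors row_minors_def by blast
  then show "I_2 (two_rows i j A) \<subseteq> Idl\<^bsub>ring_of_type_algebra\<^esub> (row_minors a b)"
    using genideal_subset_iff[OF J] unfolding I_2_def by blast
  have less: "var (a k) * var (b l) - var (a l) * var (b k) \<in> I_2 (two_rows i j A)"
    if "k < l" for k l
    using genideal_subset_iff[OF I, of "minors_2 (two_rows i j A)"] that
    unfolding I_2_def minors by blast
  have "var (a k) * var (b l) - var (a l) * var (b k) \<in> I_2 (two_rows i j A)" for k l
  proof (cases k l rule: linorder_cases)
    case equal
    then show ?thesis by (simp add: ideal_zero_mem[OF I])
  next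
    case greater
    from ideal_uminus_mem[OF I less[OF this]] show ?thesis by simp
  qed (rule less)
  then have "row_minors a b \<subseteq> I_2 (two_rows i j A)"
    by (auto simp: row_minors_def)
  then show "Idl\<^bsub>ring_of_type_algebra\<^esub> (row_minors a b) \<subseteq> I_2 (two_rows i j A)"
    by (simp add: genideal_subset_iff[OF I])
qed

lemma inj_XVar_YVar_nat:
  fixes h :: "'p \<Rightarrow> nat" and k :: "'n \<Rightarrow> nat"
  assumes "inj h" "inj k"
  shows "inj (case_indet (\<lambda>p. 2 * h p) (\<lambda>s. Suc (2 * k s)))"
proof (rule injI)
  fix u v :: "('p, 'n) indet"
  assume "case_indet (\<lambda>p. 2 * h p) (\<lambda>s. Suc (2 * k s)) u =
      case_indet (\<lambda>p. 2 * h p) (\<lambda>s. Suc (2 * k s)) v"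
  then show "u = v"
    using assms by (cases u; cases v) (simp_all add: inj_eq, presburger+)
qed

text \<open>
  Both matrices have the indeterminate with index \<open>p r s\<close> at position \<open>(r, s)\<close>, where \<open>p\<close> forms the
  ordered or the unordered pair.
\<close>

lemma matrix_rows_transversal:
  fixes A :: "((('p, 'n::{finite,linorder}, 'k::field) mpoly_ring, 'n) vec, 'n) vec"
  assumes A: "\<And>r s. A $ r $ s = indet_poly (XVar (p r s))"
    and fin: "finite (UNIV :: 'p set)" and i_neq_j: "i \<noteq> j"
    and inj: "\<And>r. inj (p r)"
    and columns: "S = UNIV \<or> S = - {i, j}"
    and overlap: "\<And>s t. p i s = p j t \<longleftrightarrow> S \<noteq> UNIV \<and> s = j \<and> t = i"
  shows "I_2 (two_rows i j A) \<inter> (PIdl\<^bsub>ring_of_type_algebra\<^esub> ((A *v y_column) $ i)) =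
    I_2 (two_rows i j A) \<cdot>\<^bsub>ring_of_type_algebra\<^esub> (PIdl\<^bsub>ring_of_type_algebra\<^esub> ((A *v y_column) $ i))"
proof -
  obtain h :: "'p \<Rightarrow> nat" where h: "inj h"
    using finite_imp_inj_to_nat_seg[OF fin] by blast
  obtain k :: "'n \<Rightarrow> nat" where k: "inj k"
    using finite_imp_inj_to_nat_seg[OF finite[of "UNIV :: 'n set"]] by blast
  define a b y :: "'n \<Rightarrow> ('p, 'n) indet"
    where "a s = XVar (p i s)" and "b s = XVar (p j s)" and "y s = YVar s" for s
  interpret row_pair a b i j S "case_indet (\<lambda>p. 2 * h p) (\<lambda>s. Suc (2 * k s))"
    by unfold_locales
      (use inj inj_XVar_YVar_nat[OF h k] i_neq_j columns overlap in
        \<open>auto simp: a_def b_def inj_def\<close>)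
  have I: "I_2 (two_rows i j A) = Idl\<^bsub>ring_of_type_algebra\<^esub> (row_minors a b)"
    by (rule I_2_two_rows) (simp_all add: A a_def b_def indet_poly_def)
  have g: "(A *v y_column) $ i = (\<Sum>s\<in>UNIV. var (a s) * var (y s))"
    by (simp add: matrix_vector_mult_def A y_column_def a_def y_def indet_poly_def)
  have "inj y" "range y \<inter> range a = {}" "range y \<inter> range b = {}"
    by (auto simp: inj_def y_def a_def b_def)
  then show ?thesis
    unfolding I g by (rule row_minors_transversal)
qed

lemma finite_UNIV_uprod: "finite (UNIV :: 'n::finite uprod set)"
proof -
  have "(UNIV :: 'n uprod set) = range (\<lambda>(r, s). Upair r s)"
    by (metis UNIV_eq_I case_prod_conv rangeI uprod_exhaust)
  then show ?thesis by (metis finite_imageI finite)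
qed

theorem lemma6p2:
  fixes i j :: "'n::{finite,linorder}"
    and Xg :: "((('n \<times> 'n, 'n, 'k::field) mpoly_ring, 'n) vec, 'n) vec"
    and Yg :: "(('n \<times> 'n, 'n, 'k) mpoly_ring, 'n) vec"
    and Xs :: "((('n uprod, 'n, 'k) mpoly_ring, 'n) vec, 'n) vec"
    and Ys :: "(('n uprod, 'n, 'k) mpoly_ring, 'n) vec"
  assumes "Xg = generic_matrix" and "Yg = y_column"
    and "Xs = generic_sym_matrix" and "Ys = y_column"
  assumes "CARD('n) \<ge> 2" and "i < j"
  shows "I_2 (two_rows i j Xg) \<inter> (PIdl\<^bsub>ring_of_type_algebra\<^esub> ((Xg *v Yg) $ i))
           = I_2 (two_rows i j Xg) \<cdot>\<^bsub>ring_of_type_algebra\<^esub> (PIdl\<^bsub>ring_of_type_algebra\<^esub> ((Xg *v Yg) $ i))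
       \<and> I_2 (two_rows i j Xs) \<inter> (PIdl\<^bsub>ring_of_type_algebra\<^esub> ((Xs *v Ys) $ i))
           = I_2 (two_rows i j Xs) \<cdot>\<^bsub>ring_of_type_algebra\<^esub> (PIdl\<^bsub>ring_of_type_algebra\<^esub> ((Xs *v Ys) $ i))"
proof
  show "I_2 (two_rows i j Xg) \<inter> (PIdl\<^bsub>ring_of_type_algebra\<^esub> ((Xg *v Yg) $ i))
      = I_2 (two_rows i j Xg) \<cdot>\<^bsub>ring_of_type_algebra\<^esub> (PIdl\<^bsub>ring_of_type_algebra\<^esub> ((Xg *v Yg) $ i))"
    unfolding assms(1,2)
    by (rule matrix_rows_transversal[where p = Pair and S = UNIV])
      (use assms(6) in \<open>auto simp: generic_matrix_def inj_def\<close>)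
  show "I_2 (two_rows i j Xs) \<inter> (PIdl\<^bsub>ring_of_type_algebra\<^esub> ((Xs *v Ys) $ i))
      = I_2 (two_rows i j Xs) \<cdot>\<^bsub>ring_of_type_algebra\<^esub> (PIdl\<^bsub>ring_of_type_algebra\<^esub> ((Xs *v Ys) $ i))"
    unfolding assms(3,4)
    by (rule matrix_rows_transversal[where p = Upair and S = "- {i, j}"])
      (use assms(6) in \<open>auto simp: generic_sym_matrix_def inj_def finite_UNIV_uprod\<close>)
qed

end
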